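(* Let $c_{3,0}\neq0$ and $c_{0,1}\neq0$. The first-order linear partial differential equation $$3c_{3,0}f_s+2c_{0,1}s f_t+c_{0,1}t=0$$ for $f=f(t,s)$ can be solved by the method of characteristics (with $s$ as characteristic parameter, $t-\frac{c_{0,1}}{3c_{3,0}}s^2$ being constant along each characteristic), which yields $$f(t,s)=F\left(t-\frac{c_{0,1}}{3c_{3,0}}s^2\right)-\frac{c_{0,1}}{3c_{3,0}}st+\frac{2c_{0,1}^2}{27c_{3,0}^2}s^3,$$ where $F$ is an arbitrary function. Setting $s=0$ gives $f(t,0)=F(t)$, so the arbitrary function $F$ is precisely the restriction of $f$ to the slice $s=0$. Moreover, setting $s=0$ directly in the equation gives $$f_s(t,0)=-\frac{c_{0,1}}{3c_{3,0}}\,t.$$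
   Context: Subscripts denote partial derivatives, and $f$ is taken to be a sufficiently smooth real-valued function of $(t,s)$ on a set $I\subset\mathbb R^2$. The equation arises as follows. Let $D=\partial/\partial x$, $P_{t,s}=\exp\left(\frac t2D^2-\frac s3D^3\right)$ and $L_3=c_{3,0}D^3+c_{0,0}+c_{0,1}x$, and let $N_3=P_{t,s}L_3P_{t,s}^{-1}=(c_{0,0}+c_{0,1}x)+c_{0,1}tD-c_{0,1}sD^2+c_{3,0}D^3$. If $v=v(t,s,x)$ satisfies $v_t=\frac12v_{xx}$, $v_s=-\frac13v_{xxx}$, $N_3v=0$ and the absorbing boundary condition $v(t,s,f(t,s))=0$, with $v_x\neq0$ on $x=f(t,s)$, then restricting $N_3v=0$ to $x=f(t,s)$ gives the displayed equation for $f$ (the first Heat--Airy compatibility equation). The slice $s=0$ is called the Heat slice.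
   Formalization: That every solution has the stated form with a single F is proved when each characteristic meets the open set I in a connected set; otherwise it can fail (two separate pieces of I on the same characteristics may carry different F). Smooth is read as C^1. *)

theory Defs
  imports "HOL-Analysis.Analysis"
begin

text \<open>Functions of \<open>(t, s)\<close> are functions on \<open>real \<times> real\<close>; the slice \<open>s = 0\<close> consists of
  the points \<open>(t, 0)\<close>.\<close>

definition partial_t :: "(real \<times> real \<Rightarrow> real) \<Rightarrow> real \<times> real \<Rightarrow> real" where
  "partial_t f p = deriv (\<lambda>t. f (t, snd p)) (fst p)"

definition partial_s :: "(real \<times> real \<Rightarrow> real) \<Rightarrow> real \<times> real \<Rightarrow> real" where
  "partial_s f p = deriv (\<lambda>s. f (fst p, s)) (snd p)"

text \<open>``Sufficiently smooth'' is read as \<open>C\<^sup>1\<close> on an open set, the natural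
  class for a first-order equation. The library's \<open>C1_differentiable_on\<close> only covers
  functions of one real variable.\<close>

definition C1_on :: "(real \<times> real) set \<Rightarrow> (real \<times> real \<Rightarrow> real) \<Rightarrow> bool" where
  "C1_on I f \<longleftrightarrow>
     (\<exists>f' :: real \<times> real \<Rightarrow> (real \<times> real) \<Rightarrow>\<^sub>L real.
        (\<forall>p\<in>I. (f has_derivative blinfun_apply (f' p)) (at p)) \<and> continuous_on I f')"

definition satisfies_pde :: "real \<Rightarrow> real \<Rightarrow> (real \<times> real) set \<Rightarrow> (real \<times> real \<Rightarrow> real) \<Rightarrow> bool" where
  "satisfies_pde c30 c01 I f \<longleftrightarrow>
     (\<forall>(t, s)\<in>I. 3 * c30 * partial_s f (t, s) + 2 * c01 * s * partial_t f (t, s) + c01 * t = 0)"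

definition solution :: "real \<Rightarrow> real \<Rightarrow> (real \<times> real) set \<Rightarrow> (real \<times> real \<Rightarrow> real) \<Rightarrow> bool" where
  "solution c30 c01 I f \<longleftrightarrow> C1_on I f \<and> satisfies_pde c30 c01 I f"

text \<open>A characteristic \<open>s \<mapsto> (T s, s)\<close>, parametrized by \<open>s\<close> in an interval \<open>J\<close>: its slope
  \<open>dt/ds\<close> is the quotient of the coefficients of \<open>f\<^sub>t\<close> and \<open>f\<^sub>s\<close>.\<close>

definition characteristic :: "real \<Rightarrow> real \<Rightarrow> real set \<Rightarrow> (real \<Rightarrow> real) \<Rightarrow> bool" where
  "characteristic c30 c01 J T \<longleftrightarrow>
     is_interval J \<and>
     (\<forall>s\<in>J. (T has_real_derivative (2 * c01 * s) / (3 * c30)) (at s within J))"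

text \<open>The maximal characteristic through \<open>(\<tau>, 0)\<close> is \<open>s \<mapsto> (\<tau> + c01 / (3 * c30) * s\<^sup>2, s)\<close>.
  If it met \<open>I\<close> in several pieces, a solution could use a different value of the
  arbitrary function on each piece.\<close>

definition connected_characteristics :: "real \<Rightarrow> real \<Rightarrow> (real \<times> real) set \<Rightarrow> bool" where
  "connected_characteristics c30 c01 I \<longleftrightarrow>
     (\<forall>\<tau>. connected {s. (\<tau> + c01 / (3 * c30) * s\<^sup>2, s) \<in> I})"

end

theory Submission
  imports Defs
begin

text \<open>With \<open>k = c01 / (3 * c30)\<close> the equation reads \<open>f\<^sub>s + 2 k s f\<^sub>t = - k t\<close>, so along
  \<open>t = \<tau> + k s\<^sup>2\<close> it says \<open>d/ds f = - k (\<tau> + k s\<^sup>2)\<close>. Integrating,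
  \<open>f + k s t - (2/3) k\<^sup>2 s\<^sup>3\<close> is constant along each characteristic inside \<open>I\<close> and hence a
  function \<open>F\<close> of \<open>\<tau>\<close>; \<open>F\<close> is \<open>C\<^sup>1\<close> because locally it can be read off on a line \<open>s = const\<close>.\<close>

section \<open>Chain rule along curves, partial derivatives and C1 functions\<close>

text \<open>The chain rule for a plane curve with velocity \<open>(a, b)\<close>. Derivatives within
  \<open>S\<close> are kept because the parameter interval of a characteristic may contain its
  endpoints.\<close>

lemma has_real_derivative_compose_curve:
  fixes f :: "real \<times> real \<Rightarrow> real"
  assumes f: "(f has_derivative f') (at (u x, v x))"
    and u: "(u has_real_derivative a) (at x within S)"
    and v: "(v has_real_derivative b) (at x within S)"
  shows "((\<lambda>x. f (u x, v x)) has_real_derivative f' (a, b)) (at x within S)"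
proof -
  have "((\<lambda>x. (u x, v x)) has_derivative (\<lambda>h. (a * h, b * h))) (at x within S)"
    using u v unfolding has_field_derivative_def by (intro has_derivative_Pair)
  then have "((\<lambda>x. f (u x, v x)) has_derivative (\<lambda>h. f' (a * h, b * h))) (at x within S)"
    using has_derivative_compose f by fast
  moreover have "f' (a * h, b * h) = f' (a, b) * h" for h
    using linear_scale[OF has_derivative_linear[OF f], of h "(a, b)"] by (simp add: mult.commute)
  ultimately show ?thesis
    by (simp add: has_field_derivative_def)
qed

text \<open>A linear functional on the plane is determined by its values on \<open>(1, 0)\<close>
  and \<open>(0, 1)\<close>; the chain rule on the coordinate lines through \<open>p\<close>
  identifies these values.\<close>

lemma has_derivative_imp_partials:
  assumes f: "(f has_derivative f') (at p)"
  shows "f' h = partial_t f p * fst h + partial_s f p * snd h"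
proof -
  have "((\<lambda>t. f (t, snd p)) has_real_derivative f' (1, 0)) (at (fst p))"
    by (rule has_real_derivative_compose_curve) (use f in \<open>auto intro!: derivative_eq_intros\<close>)
  then have t: "f' (1, 0) = partial_t f p"
    unfolding partial_t_def by (simp add: DERIV_imp_deriv)
  have "((\<lambda>s. f (fst p, s)) has_real_derivative f' (0, 1)) (at (snd p))"
    by (rule has_real_derivative_compose_curve) (use f in \<open>auto intro!: derivative_eq_intros\<close>)
  then have s: "f' (0, 1) = partial_s f p"
    unfolding partial_s_def by (simp add: DERIV_imp_deriv)
  have "f' h = f' (fst h *\<^sub>R (1, 0) + snd h *\<^sub>R (0, 1))"
    by simp
  also have "\<dots> = fst h *\<^sub>R f' (1, 0) + snd h *\<^sub>R f' (0, 1)"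
    by (simp only: linear_add[OF has_derivative_linear[OF f]]
        linear_scale[OF has_derivative_linear[OF f]])
  finally show ?thesis
    unfolding t s by (simp add: mult.commute)
qed

lemma C1_on_imp_has_derivative:
  assumes "C1_on I f" "p \<in> I"
  shows "(f has_derivative (\<lambda>h. partial_t f p * fst h + partial_s f p * snd h)) (at p)"
proof -
  obtain f' where f': "(f has_derivative f') (at p)"
    using assms unfolding C1_on_def by blast
  moreover have "f' = (\<lambda>h. partial_t f p * fst h + partial_s f p * snd h)"
    using has_derivative_imp_partials[OF f'] by blast
  ultimately show ?thesis by simp
qed

text \<open>Evaluation at the fixed vector \<open>(1, 0)\<close> is continuous in the operator. This
  later yields continuity of the derivative of \<open>F\<close>.\<close>

lemma C1_on_imp_continuous_on_partial_t:
  assumes "C1_on I f"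
  shows "continuous_on I (partial_t f)"
proof -
  obtain f' :: "real \<times> real \<Rightarrow> (real \<times> real) \<Rightarrow>\<^sub>L real"
    where f': "\<And>p. p \<in> I \<Longrightarrow> (f has_derivative blinfun_apply (f' p)) (at p)"
      and cont: "continuous_on I f'"
    using assms unfolding C1_on_def by blast
  have "continuous_on I (\<lambda>p. blinfun_apply (f' p) (1, 0))"
    using cont by (intro continuous_intros)
  moreover have "blinfun_apply (f' p) (1, 0) = partial_t f p" if "p \<in> I" for p
    using has_derivative_imp_partials[OF f'[OF that], of "(1, 0)"] by simp
  ultimately show ?thesis
    by (simp cong: continuous_on_cong)
qed

text \<open>The two coordinate projections, weighted by the coefficients, form a bounded operator
  that varies continuously with \<open>p\<close>.\<close>

lemma C1_onI:
  assumes "\<And>p. p \<in> I \<Longrightarrow> (f has_derivative (\<lambda>h. a p * fst h + b p * snd h)) (at p)"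
    and "continuous_on I a" "continuous_on I b"
  shows "C1_on I f"
proof -
  define f' :: "real \<times> real \<Rightarrow> (real \<times> real) \<Rightarrow>\<^sub>L real"
    where "f' p = a p *\<^sub>R fst_blinfun + b p *\<^sub>R snd_blinfun" for p
  have "blinfun_apply (f' p) = (\<lambda>h. a p * fst h + b p * snd h)" for p
    by (auto simp: f'_def blinfun.add_left blinfun.scaleR_left)
  moreover have "continuous_on I f'"
    unfolding f'_def using assms(2,3) by (intro continuous_intros)
  ultimately show ?thesis
    unfolding C1_on_def using assms(1) by (intro exI[of _ f']) simp
qed

section \<open>The equation and its characteristics\<close>

text \<open>Division by \<open>3 * c30\<close> exposes, for differentiable \<open>f\<close>, the
  derivative in direction \<open>(2 * k * s, 1)\<close>, the velocity of a characteristic.\<close>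

lemma satisfies_pde_iff:
  fixes c30 c01 :: real
  assumes "c30 \<noteq> 0"
  defines "k \<equiv> c01 / (3 * c30)"
  shows "satisfies_pde c30 c01 I f \<longleftrightarrow>
    (\<forall>(t, s)\<in>I. 2 * k * s * partial_t f (t, s) + partial_s f (t, s) = - k * t)"
proof -
  have "c01 = 3 * c30 * k"
    using assms(1) by (simp add: k_def)
  then have "3 * c30 * y + 2 * c01 * s * x + c01 * t = 3 * c30 * (2 * k * s * x + y + k * t)"
    for x y s t :: real
    by (simp add: algebra_simps)
  then have "3 * c30 * y + 2 * c01 * s * x + c01 * t = 0 \<longleftrightarrow> 2 * k * s * x + y = - k * t"
    for x y s t :: real
    using assms(1) by (simp add: eq_neg_iff_add_eq_0)
  then show ?thesis
    unfolding satisfies_pde_def by simp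
qed

text \<open>The prescribed slope has the antiderivative \<open>c01 / (3 * c30) * s\<^sup>2\<close>,
  so the difference has derivative zero and is constant on the convex set \<open>J\<close>.\<close>

lemma characteristic_iff:
  assumes "c30 \<noteq> 0"
  shows "characteristic c30 c01 J T \<longleftrightarrow>
    is_interval J \<and> (\<lambda>s. T s - c01 / (3 * c30) * s\<^sup>2) constant_on J"
proof (intro iffI conjI)
  assume ch: "characteristic c30 c01 J T"
  then show J: "is_interval J"
    by (simp add: characteristic_def)
  have "((\<lambda>s. T s - c01 / (3 * c30) * s\<^sup>2) has_real_derivative 0) (at s within J)" if "s \<in> J" for s
  proof -
    have "(T has_real_derivative (2 * c01 * s) / (3 * c30)) (at s within J)"
      using ch that by (simp add: characteristic_def)
    then show ?thesis
      using assms by (auto intro!: derivative_eq_intros)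
  qed
  then show "(\<lambda>s. T s - c01 / (3 * c30) * s\<^sup>2) constant_on J"
    unfolding constant_on_def
    using has_field_derivative_zero_constant[OF is_interval_convex[OF J]] by blast
next
  assume "is_interval J \<and> (\<lambda>s. T s - c01 / (3 * c30) * s\<^sup>2) constant_on J"
  then obtain \<tau> where J: "is_interval J" and "\<And>s. s \<in> J \<Longrightarrow> T s - c01 / (3 * c30) * s\<^sup>2 = \<tau>"
    unfolding constant_on_def by blast
  then have T: "T s = \<tau> + c01 / (3 * c30) * s\<^sup>2" if "s \<in> J" for s
    using that by (simp add: algebra_simps)
  \<comment> \<open>\<open>T\<close> is known only on \<open>J\<close>; the derivative of the
    parabola carries over because it is taken within \<open>J\<close>.\<close>
  have "(T has_real_derivative (2 * c01 * s) / (3 * c30)) (at s within J)" if "s \<in> J" for s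
    unfolding has_field_derivative_def
  proof (rule has_derivative_transform[OF that T])
    have "((\<lambda>s. \<tau> + c01 / (3 * c30) * s\<^sup>2) has_real_derivative (2 * c01 * s) / (3 * c30))
      (at s within J)"
      using assms by (auto intro!: derivative_eq_intros)
    then show "((\<lambda>s. \<tau> + c01 / (3 * c30) * s\<^sup>2) has_derivative (*) ((2 * c01 * s) / (3 * c30)))
      (at s within J)"
      by (simp only: has_field_derivative_def)
  qed
  with J show "characteristic c30 c01 J T"
    by (simp add: characteristic_def)
qed

lemma C1_on_derivative_along_characteristic:
  assumes f: "C1_on I f" and ch: "characteristic c30 c01 J T" and s: "s \<in> J" "(T s, s) \<in> I"
  shows "((\<lambda>s. f (T s, s)) has_real_derivative
    2 * (c01 / (3 * c30)) * s * partial_t f (T s, s) + partial_s f (T s, s)) (at s within J)"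
proof -
  have "(T has_real_derivative (2 * c01 * s) / (3 * c30)) (at s within J)"
    using ch s(1) by (simp add: characteristic_def)
  from has_real_derivative_compose_curve[OF C1_on_imp_has_derivative[OF f s(2)] this DERIV_ident]
  show ?thesis
    by (simp add: mult_ac)
qed

lemma open_vimage_characteristic:
  assumes "open (I :: (real \<times> real) set)"
  shows "open {s. (\<tau> + k * s\<^sup>2, s) \<in> I}"
  using open_vimage[OF assms, of "\<lambda>s. (\<tau> + k * s\<^sup>2, s)"]
  by (simp add: vimage_def continuous_intros)

text \<open>Forwards, the chain rule turns the equation into the ODE. Backwards, openness of
  \<open>I\<close> puts each of its points on a short characteristic inside \<open>I\<close>, where
  the ODE and the chain rule give two values of the same derivative.\<close>

lemma satisfies_pde_iff_characteristics:
  assumes c30: "c30 \<noteq> 0" and I: "open I" and f: "C1_on I f"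
  shows "satisfies_pde c30 c01 I f \<longleftrightarrow>
    (\<forall>J T. characteristic c30 c01 J T \<and> (\<forall>s\<in>J. (T s, s) \<in> I) \<longrightarrow>
       (\<forall>s\<in>J. ((\<lambda>s. f (T s, s)) has_real_derivative - (c01 * T s) / (3 * c30)) (at s within J)))"
    (is "_ \<longleftrightarrow> ?ode")
proof
  assume pde: "satisfies_pde c30 c01 I f"
  show ?ode
  proof (intro allI impI ballI, elim conjE)
    fix J T s
    assume ch: "characteristic c30 c01 J T" and J: "\<forall>s\<in>J. (T s, s) \<in> I" and s: "s \<in> J"
    have "2 * (c01 / (3 * c30)) * s * partial_t f (T s, s) + partial_s f (T s, s)
        = - (c01 * T s) / (3 * c30)"
      using pde J s by (fastforce simp: satisfies_pde_iff[OF c30])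
    then show "((\<lambda>s. f (T s, s)) has_real_derivative - (c01 * T s) / (3 * c30)) (at s within J)"
      using C1_on_derivative_along_characteristic[OF f ch s] J s by simp
  qed
next
  assume ode: ?ode
  define k where "k = c01 / (3 * c30)"
  have "2 * k * s * partial_t f (t, s) + partial_s f (t, s) = - k * t" if ts: "(t, s) \<in> I" for t s
  proof -
    \<comment> \<open>The constant is chosen so that the characteristic passes through
      \<open>(t, s)\<close>.\<close>
    define T where "T r = (t - k * s\<^sup>2) + k * r\<^sup>2" for r
    have "open {r. (T r, r) \<in> I}" and Ts: "T s = t"
      unfolding T_def using open_vimage_characteristic[OF I] by auto
    moreover have "s \<in> {r. (T r, r) \<in> I}"
      using ts Ts by simp
    ultimately obtain e where e: "e > 0" "ball s e \<subseteq> {r. (T r, r) \<in> I}"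
      by (elim openE)
    have ch: "characteristic c30 c01 (ball s e) T"
      unfolding characteristic_iff[OF c30] T_def k_def constant_on_def
      by (auto simp: is_interval_ball_real)
    \<comment> \<open>On an open interval the derivative is two-sided, hence unique.\<close>
    have s: "s \<in> ball s e" "at s within ball s e = at s"
      using e(1) by (auto intro: at_within_open)
    have "((\<lambda>r. f (T r, r)) has_real_derivative - (c01 * T s) / (3 * c30)) (at s)"
      using ode ch e(2) s by fastforce
    moreover have "((\<lambda>r. f (T r, r)) has_real_derivative
        2 * k * s * partial_t f (t, s) + partial_s f (t, s)) (at s)"
      using C1_on_derivative_along_characteristic[OF f ch s(1)] s(2) ts Ts by (simp add: k_def)
    ultimately show ?thesis
      using DERIV_unique Ts by (fastforce simp: k_def)
  qed
  then show "satisfies_pde c30 c01 I f"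
    unfolding satisfies_pde_iff[OF c30] k_def by blast
qed

section \<open>From solutions to the general form\<close>

text \<open>The terms added to \<open>f\<close> in \<open>g\<close> cancel its rate of change along
  a characteristic. This makes the arbitrary function well defined.\<close>

lemma solution_constant_along_characteristic:
  assumes c30: "c30 \<noteq> 0" and I: "open I" and conn: "connected_characteristics c30 c01 I"
    and sol: "solution c30 c01 I f"
  defines "k \<equiv> c01 / (3 * c30)"
  defines "g \<equiv> \<lambda>(t, s). f (t, s) + k * s * t - 2 / 3 * k\<^sup>2 * s ^ 3"
  assumes p: "(t, s) \<in> I" "(t', s') \<in> I" "t - k * s\<^sup>2 = t' - k * s'\<^sup>2"
  shows "g (t, s) = g (t', s')"
proof -
  define \<tau> where "\<tau> = t - k * s\<^sup>2"
  define T where "T r = \<tau> + k * r\<^sup>2" for r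
  define J where "J = {r. (T r, r) \<in> I}"
  have T: "t = T s" "t' = T s'"
    using p(3) by (simp_all add: T_def \<tau>_def)
  \<comment> \<open>Connectedness enters here: a zero derivative on several pieces would give only
    one constant per piece.\<close>
  have "is_interval J"
    using conn by (simp add: J_def T_def k_def connected_characteristics_def is_interval_connected_1)
  then have ch: "characteristic c30 c01 J T" and conv: "convex J"
    unfolding characteristic_iff[OF c30] T_def k_def constant_on_def
    by (auto simp: is_interval_convex)
  have "((\<lambda>r. g (T r, r)) has_real_derivative 0) (at r within J)" if r: "r \<in> J" for r
  proof -
    have "((\<lambda>r. f (T r, r)) has_real_derivative - k * T r) (at r within J)"
      using sol ch r satisfies_pde_iff_characteristics[OF c30 I]
      by (fastforce simp: solution_def J_def k_def)
    \<comment> \<open>The three contributions are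
      \<open>- k * \<tau> - k\<^sup>2 * r\<^sup>2\<close>,
      \<open>k * \<tau> + 3 * k\<^sup>2 * r\<^sup>2\<close> and
      \<open>- 2 * k\<^sup>2 * r\<^sup>2\<close>, with sum zero.\<close>
    then show ?thesis
      unfolding g_def T_def
      by (auto intro!: derivative_eq_intros simp: algebra_simps power2_eq_square)
  qed
  then obtain c where "\<And>r. r \<in> J \<Longrightarrow> g (T r, r) = c"
    using has_field_derivative_zero_constant[OF conv] by blast
  then show ?thesis
    using p(1,2) by (simp add: T J_def)
qed

lemma solution_imp_general_form:
  assumes c30: "c30 \<noteq> 0" and I: "open I" and conn: "connected_characteristics c30 c01 I"
    and sol: "solution c30 c01 I f"
  defines "k \<equiv> c01 / (3 * c30)"
  shows "\<exists>F :: real \<Rightarrow> real. F C1_differentiable_on ((\<lambda>(t, s). t - k * s\<^sup>2) ` I) \<and>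
    (\<forall>(t, s)\<in>I. f (t, s) = F (t - k * s\<^sup>2) - k * s * t + 2 / 3 * k\<^sup>2 * s ^ 3)"
proof -
  define g where "g = (\<lambda>(t, s). f (t, s) + k * s * t - 2 / 3 * k\<^sup>2 * s ^ 3)"
  \<comment> \<open>Any point of \<open>I\<close> on the characteristic labelled
    \<open>\<tau>\<close> gives the same value of \<open>g\<close>; for labels of characteristics
    missing \<open>I\<close> the value is unspecified.\<close>
  define F where "F \<tau> = g (SOME p. p \<in> I \<and> fst p - k * (snd p)\<^sup>2 = \<tau>)" for \<tau>
  \<comment> \<open>The labels of the characteristics that meet \<open>I\<close> at height
    \<open>s\<close>. The function \<open>D s\<close> below is the derivative of
    \<open>g (\<tau> + k * s\<^sup>2, s)\<close> in \<open>\<tau>\<close>.\<close>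
  define U where "U s = {\<tau>. (\<tau> + k * s\<^sup>2, s) \<in> I}" for s
  define D where "D s \<tau> = partial_t f (\<tau> + k * s\<^sup>2, s) + k * s" for s \<tau>
  have C1: "C1_on I f"
    using sol by (simp add: solution_def)
  have F: "F (t - k * s\<^sup>2) = g (t, s)" if "(t, s) \<in> I" for t s
    unfolding F_def
  proof (rule someI2[of _ "(t, s)"])
    show "g p = g (t, s)" if "p \<in> I \<and> fst p - k * (snd p)\<^sup>2 = t - k * s\<^sup>2" for p
      using solution_constant_along_characteristic[OF c30 I conn sol, of "fst p" "snd p" t s]
        that \<open>(t, s) \<in> I\<close> by (simp add: g_def k_def split_beta)
  qed (use that in simp)
  have U: "open (U s)" for s
    unfolding U_def using open_vimage[OF I, of "\<lambda>\<tau>. (\<tau> + k * s\<^sup>2, s)"]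
    by (simp add: vimage_def continuous_intros)
  \<comment> \<open>With \<open>s\<close> frozen, \<open>F\<close> agrees on the open set
    \<open>U s\<close> with \<open>g\<close> along a horizontal line, so only the
    \<open>t\<close>-derivative of \<open>f\<close> appears.\<close>
  have dF: "(F has_real_derivative D s \<tau>) (at \<tau>)" if "\<tau> \<in> U s" for s \<tau>
  proof (rule has_field_derivative_transform_within_open[OF _ U that])
    have "((\<lambda>\<tau>. f (\<tau> + k * s\<^sup>2, s)) has_real_derivative partial_t f (\<tau> + k * s\<^sup>2, s)) (at \<tau>)"
    proof (rule DERIV_cong)
      show "((\<lambda>\<tau>. f (\<tau> + k * s\<^sup>2, s)) has_real_derivative
          (\<lambda>h. partial_t f (\<tau> + k * s\<^sup>2, s) * fst h + partial_s f (\<tau> + k * s\<^sup>2, s) * snd h) (1, 0)) (at \<tau>)"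
        by (rule has_real_derivative_compose_curve[OF C1_on_imp_has_derivative[OF C1]])
          (use that in \<open>auto simp: U_def intro!: derivative_eq_intros\<close>)
    qed simp
    then show "((\<lambda>\<tau>. g (\<tau> + k * s\<^sup>2, s)) has_real_derivative D s \<tau>) (at \<tau>)"
      unfolding g_def D_def by (auto intro!: derivative_eq_intros)
    show "g (\<tau>' + k * s\<^sup>2, s) = F \<tau>'" if "\<tau>' \<in> U s" for \<tau>'
      using F[of "\<tau>' + k * s\<^sup>2" s] that by (simp add: U_def)
  qed
  have img: "(\<lambda>(t, s). t - k * s\<^sup>2) ` I = (\<Union>s. U s)"
  proof (rule equalityI)
    have "t - k * s\<^sup>2 \<in> (\<Union>s. U s)" if "(t, s) \<in> I" for t s
      using that by (intro UN_I[of s]) (simp_all add: U_def)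
    then show "(\<lambda>(t, s). t - k * s\<^sup>2) ` I \<subseteq> (\<Union>s. U s)"
      by (intro image_subsetI) (simp only: split_paired_all prod.case)
    have "\<tau> \<in> (\<lambda>(t, s). t - k * s\<^sup>2) ` I" if "\<tau> \<in> U s" for \<tau> s
      using that by (intro image_eqI[of _ _ "(\<tau> + k * s\<^sup>2, s)"]) (auto simp: U_def)
    then show "(\<Union>s. U s) \<subseteq> (\<lambda>(t, s). t - k * s\<^sup>2) ` I"
      by (intro UN_least subsetI)
  qed
  \<comment> \<open>The formula \<open>D s\<close> depends on the chosen line while
    \<open>deriv F\<close> does not, so continuity of \<open>deriv F\<close> can be glued from the
    open sets \<open>U s\<close>.\<close>
  have "continuous_on (\<Union>s. U s) (deriv F)"
  proof (rule continuous_on_open_UN)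
    fix s
    have "continuous_on (U s) (D s)"
      unfolding D_def
      by (intro continuous_intros
          continuous_on_compose2[OF C1_on_imp_continuous_on_partial_t[OF C1]])
        (auto simp: U_def)
    moreover have "deriv F \<tau> = D s \<tau>" if "\<tau> \<in> U s" for \<tau>
      using dF[OF that] by (rule DERIV_imp_deriv)
    ultimately show "continuous_on (U s) (deriv F)"
      by (simp cong: continuous_on_cong)
  qed (rule U)
  moreover have "(F has_vector_derivative deriv F \<tau>) (at \<tau>)" if "\<tau> \<in> (\<Union>s. U s)" for \<tau>
    using that dF
    by (metis DERIV_imp_deriv UN_E has_real_derivative_iff_has_vector_derivative)
  ultimately have "F C1_differentiable_on ((\<lambda>(t, s). t - k * s\<^sup>2) ` I)"
    unfolding C1_differentiable_on_def img by blast
  moreover have "\<forall>(t, s)\<in>I. f (t, s) = F (t - k * s\<^sup>2) - k * s * t + 2 / 3 * k\<^sup>2 * s ^ 3"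
    using F by (auto simp: g_def)
  ultimately show ?thesis
    by blast
qed

section \<open>From the general form to solutions\<close>

lemma general_form_imp_solution:
  fixes c30 c01 :: real and F :: "real \<Rightarrow> real"
  assumes c30: "c30 \<noteq> 0" and I: "open I"
  defines "k \<equiv> c01 / (3 * c30)"
  assumes f: "\<And>t s. (t, s) \<in> I \<Longrightarrow> f (t, s) = F (t - k * s\<^sup>2) - k * s * t + 2 / 3 * k\<^sup>2 * s ^ 3"
    and F: "F C1_differentiable_on ((\<lambda>(t, s). t - k * s\<^sup>2) ` I)"
  shows "solution c30 c01 I f"
proof -
  define \<phi> where "\<phi> p = fst p - k * (snd p)\<^sup>2" for p :: "real \<times> real"
  have \<phi>: "(\<lambda>(t, s). t - k * s\<^sup>2) = \<phi>"
    by (auto simp: \<phi>_def)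
  obtain D where dF: "\<And>\<tau>. \<tau> \<in> \<phi> ` I \<Longrightarrow> (F has_real_derivative D \<tau>) (at \<tau>)"
    and D: "continuous_on (\<phi> ` I) D"
    using F unfolding C1_differentiable_on_def \<phi>
    by (auto simp: has_real_derivative_iff_has_vector_derivative)
  \<comment> \<open>\<open>a\<close> and \<open>b\<close> are the partial derivatives in
    \<open>t\<close> and \<open>s\<close> read off from the formula, with \<open>D\<close> the
    derivative of \<open>F\<close>.\<close>
  define a where "a p = D (\<phi> p) - k * snd p" for p
  define b where "b p = - (2 * k * snd p * D (\<phi> p)) - k * fst p + 2 * k\<^sup>2 * (snd p)\<^sup>2" for p
  have f': "(f has_derivative (\<lambda>h. a p * fst h + b p * snd h)) (at p)" if p: "p \<in> I" for p
  proof (rule has_derivative_transform_within_open[OF _ I p])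
    have "(\<phi> has_derivative (\<lambda>h. fst h - 2 * k * snd p * snd h)) (at p)"
      unfolding \<phi>_def by (auto intro!: derivative_eq_intros)
    moreover have "(F has_derivative (*) (D (\<phi> p))) (at (\<phi> p))"
      using dF p by (simp add: has_field_derivative_def)
    ultimately have "((\<lambda>p. F (\<phi> p)) has_derivative
        (\<lambda>h. D (\<phi> p) * (fst h - 2 * k * snd p * snd h))) (at p)"
      by (rule has_derivative_compose)
    then show "((\<lambda>p. F (\<phi> p) - k * snd p * fst p + 2 / 3 * k\<^sup>2 * snd p ^ 3) has_derivative
        (\<lambda>h. a p * fst h + b p * snd h)) (at p)"
      unfolding a_def b_def
      by (auto intro!: derivative_eq_intros simp: algebra_simps)
    show "F (\<phi> q) - k * snd q * fst q + 2 / 3 * k\<^sup>2 * snd q ^ 3 = f q" if "q \<in> I" for q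
      using f[of "fst q" "snd q"] that by (simp add: \<phi>_def)
  qed
  have "continuous_on I \<phi>"
    unfolding \<phi>_def by (intro continuous_intros)
  then have "continuous_on I (\<lambda>p. D (\<phi> p))"
    using continuous_on_compose2[OF D] by blast
  then have "continuous_on I a" "continuous_on I b"
    unfolding a_def b_def by (auto intro!: continuous_intros)
  then have "C1_on I f"
    using C1_onI f' by blast
  moreover have "2 * k * s * partial_t f (t, s) + partial_s f (t, s) = - k * t"
    if "(t, s) \<in> I" for t s
  proof -
    have eqs: "partial_t f (t, s) = a (t, s)" "partial_s f (t, s) = b (t, s)"
      using has_derivative_imp_partials[OF f'[OF that], of "(1, 0)"]
        has_derivative_imp_partials[OF f'[OF that], of "(0, 1)"] by simp_all
    \<comment> \<open>In \<open>2 * k * s * a + b\<close> the terms with \<open>D\<close> cancel, as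
      do those with \<open>k\<^sup>2 * s\<^sup>2\<close>, leaving \<open>- k * t\<close>.\<close>
    show ?thesis
      unfolding eqs by (simp add: a_def b_def algebra_simps power2_eq_square)
  qed
  ultimately show ?thesis
    unfolding solution_def satisfies_pde_iff[OF c30] k_def by blast
qed

section \<open>The combined statement and the slice \<open>s = 0\<close>\<close>

theorem mainTheorem5:
  fixes c30 c01 :: real
    and I :: "(real \<times> real) set"
    and f :: "real \<times> real \<Rightarrow> real"
  assumes "c30 \<noteq> 0" and "c01 \<noteq> 0" and "open I"
  shows
    "(\<forall>J T. characteristic c30 c01 J T \<longleftrightarrow>
        is_interval J \<and> (\<lambda>s. T s - c01 / (3 * c30) * s\<^sup>2) constant_on J) \<and>
     (C1_on I f \<longrightarrow>
        (satisfies_pde c30 c01 I f \<longleftrightarrow>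
          (\<forall>J T. characteristic c30 c01 J T \<and> (\<forall>s\<in>J. (T s, s) \<in> I) \<longrightarrow>
             (\<forall>s\<in>J. ((\<lambda>s. f (T s, s)) has_real_derivative - (c01 * T s) / (3 * c30))
                       (at s within J))))) \<and>
     (connected_characteristics c30 c01 I \<and> solution c30 c01 I f \<longrightarrow>
        (\<exists>F :: real \<Rightarrow> real.
           F C1_differentiable_on ((\<lambda>(t, s). t - c01 / (3 * c30) * s\<^sup>2) ` I) \<and>
           (\<forall>(t, s)\<in>I. f (t, s) = F (t - c01 / (3 * c30) * s\<^sup>2)
              - c01 / (3 * c30) * s * t + 2 * c01\<^sup>2 / (27 * c30\<^sup>2) * s ^ 3))) \<and>
     (\<forall>F :: real \<Rightarrow> real.
        (\<forall>(t, s)\<in>I. f (t, s) = F (t - c01 / (3 * c30) * s\<^sup>2)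
           - c01 / (3 * c30) * s * t + 2 * c01\<^sup>2 / (27 * c30\<^sup>2) * s ^ 3) \<longrightarrow>
        (F C1_differentiable_on ((\<lambda>(t, s). t - c01 / (3 * c30) * s\<^sup>2) ` I) \<longrightarrow>
           solution c30 c01 I f) \<and>
        (\<forall>t. (t, 0) \<in> I \<longrightarrow> f (t, 0) = F t)) \<and>
     (solution c30 c01 I f \<longrightarrow>
        (\<forall>t. (t, 0) \<in> I \<longrightarrow> partial_s f (t, 0) = - (c01 / (3 * c30)) * t))"
proof -
  \<comment> \<open>Translates the displayed cubic coefficient into the form
    \<open>2 / 3 * k\<^sup>2\<close> of the lemmas.\<close>
  have coeff: "2 * c01\<^sup>2 / (27 * c30\<^sup>2) = 2 / 3 * (c01 / (3 * c30))\<^sup>2"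
    by (simp add: power2_eq_square)
  have "F C1_differentiable_on ((\<lambda>(t, s). t - c01 / (3 * c30) * s\<^sup>2) ` I) \<longrightarrow> solution c30 c01 I f"
    "\<forall>t. (t, 0) \<in> I \<longrightarrow> f (t, 0) = F t"
    if "\<forall>(t, s)\<in>I. f (t, s) = F (t - c01 / (3 * c30) * s\<^sup>2)
      - c01 / (3 * c30) * s * t + 2 * c01\<^sup>2 / (27 * c30\<^sup>2) * s ^ 3" for F
  proof -
    show "F C1_differentiable_on ((\<lambda>(t, s). t - c01 / (3 * c30) * s\<^sup>2) ` I) \<longrightarrow> solution c30 c01 I f"
      using general_form_imp_solution[OF assms(1,3), of f F c01] that unfolding coeff by blast
    show "\<forall>t. (t, 0) \<in> I \<longrightarrow> f (t, 0) = F t"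
      using that by fastforce
  qed
  \<comment> \<open>On the slice the coefficient of \<open>partial_t f\<close> vanishes, so the
    equation itself determines \<open>partial_s f\<close>.\<close>
  moreover have "partial_s f (t, 0) = - (c01 / (3 * c30)) * t"
    if "solution c30 c01 I f" "(t, 0) \<in> I" for t
    using that by (fastforce simp: solution_def satisfies_pde_iff[OF assms(1)])
  ultimately show ?thesis
    by (intro conjI allI impI; (elim conjE)?)
      (use characteristic_iff[OF assms(1)] satisfies_pde_iff_characteristics[OF assms(1,3)]
        solution_imp_general_form[OF assms(1,3), of c01 f, folded coeff] in simp_all)
qed

end
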